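(* Let $\mu$ be a weight on $\mathbb{D}$ and let $\phi:\mathbb{D}\to\mathbb{D}$ be holomorphic. Suppose that $C_\phi:\mathcal{B}^{\log}\to\mathcal{B}^{\mu}$, i.e. that $f\circ\phi\in\mathcal{B}^{\mu}$ for every $f\in\mathcal{B}^{\log}$. Then $C_\phi$ is bounded if and only if $$\sup_{j\in\mathbb{N}}\frac{\|\phi^j\|_{\mu}}{\|F_j\|_{\log}}<\infty .$$
   Context: $\mathbb{D}$ is the open unit disk in $\mathbb{C}$, $\mathcal{H}(\mathbb{D})$ the space of holomorphic functions on $\mathbb{D}$, $\mathbb{N}=\{1,2,3,\dots\}$, and $\log$ is the natural logarithm. A weight on $\mathbb{D}$ is a bounded, continuous, strictly positive function $\mu:\mathbb{D}\to(0,\infty)$. For a weight $\mu$ and $f\in\mathcal{H}(\mathbb{D})$, put $\|f\|_\mu:=\sup_{z\in\mathbb{D}}\mu(z)|f'(z)|$; the $\mu$-Bloch space $\mathcal{B}^\mu$ is the set of $f\in\mathcal{H}(\mathbb{D})$ with $\|f\|_\mu<\infty$, a Banach space under the norm $\|f\|_{\mathcal{B}^\mu}:=|f(0)|+\|f\|_\mu$. The log-Bloch space $\mathcal{B}^{\log}$ is $\mathcal{B}^{\mu}$ for the weight $\mu=v_{\log}$, $v_{\log}(z)=(1-|z|)\log\left(\frac{3}{1-|z|}\right)$; its seminorm $\|\cdot\|_{v_{\log}}$ is written $\|\cdot\|_{\log}$. $C_\phi f:=f\circ\phi$ is the composition operator with symbol $\phi$. $F_j(z):=z^j$ on $\mathbb{D}$,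 and $\phi^j$ is the pointwise $j$th power of $\phi$. *)

theory Defs
  imports "HOL-Complex_Analysis.Complex_Analysis"
begin

text \<open>
  Functions on the unit disk are represented by total functions on \<^typ>\<open>complex\<close>;
  every notion below depends only on their values in \<^term>\<open>ball 0 1 :: complex set\<close>.
\<close>

abbreviation unit_disk :: "complex set" where
  "unit_disk \<equiv> ball 0 1"

definition weight :: "(complex \<Rightarrow> real) \<Rightarrow> bool" where
  "weight \<mu> \<longleftrightarrow> bounded (\<mu> ` unit_disk) \<and> continuous_on unit_disk \<mu> \<and> (\<forall>z\<in>unit_disk. 0 < \<mu> z)"

text \<open>
  The seminorm takes extended values, so that the supremum makes sense for every
  holomorphic function; the map \<^term>\<open>ennreal\<close> loses nothing because weights are positive on the disk.
\<close>

definition bloch_seminorm :: "(complex \<Rightarrow> real) \<Rightarrow> (complex \<Rightarrow> complex) \<Rightarrow> ennreal" where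
  "bloch_seminorm \<mu> f = (SUP z\<in>unit_disk. ennreal (\<mu> z * norm (deriv f z)))"

definition bloch_space :: "(complex \<Rightarrow> real) \<Rightarrow> (complex \<Rightarrow> complex) set" where
  "bloch_space \<mu> = {f. f holomorphic_on unit_disk \<and> bloch_seminorm \<mu> f < \<infinity>}"

definition bloch_norm :: "(complex \<Rightarrow> real) \<Rightarrow> (complex \<Rightarrow> complex) \<Rightarrow> ennreal" where
  "bloch_norm \<mu> f = ennreal (norm (f 0)) + bloch_seminorm \<mu> f"

definition v_log :: "complex \<Rightarrow> real" where
  "v_log z = (1 - norm z) * ln (3 / (1 - norm z))"

definition comp_op :: "(complex \<Rightarrow> complex) \<Rightarrow> (complex \<Rightarrow> complex) \<Rightarrow> (complex \<Rightarrow> complex)" where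
  "comp_op \<phi> f = f \<circ> \<phi>"

definition bounded_bloch_op ::
    "(complex \<Rightarrow> real) \<Rightarrow> (complex \<Rightarrow> real) \<Rightarrow> ((complex \<Rightarrow> complex) \<Rightarrow> (complex \<Rightarrow> complex)) \<Rightarrow> bool" where
  "bounded_bloch_op \<nu> \<mu> T \<longleftrightarrow>
     (\<exists>C::real. \<forall>f\<in>bloch_space \<nu>. bloch_norm \<mu> (T f) \<le> ennreal C * bloch_norm \<nu> f)"

end

theory Submission imports Defs begin

text \<open>
  The monomials detect the growth of \<^term>\<open>v_log\<close>.  For \<open>w\<close> in the disk put \<open>t = 1 - norm w\<close>.
  The weighted derivative \<open>j (1 - t)^(j-1) v_log w\<close> of \<open>z^j\<close> at \<open>w\<close> never exceeds a constant
  times \<open>ln (3 j)\<close>, so the log-Bloch seminorm of \<open>z^j\<close> is \<open>O(ln (3 j))\<close>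
  (\<open>bloch_seminorm_monomial_le\<close>); conversely, when \<open>j\<close> is the integer part of \<open>1 / t\<close>, it is at
  least a constant multiple of \<open>ln (3 j)\<close> (\<open>monomial_log_lower\<close>).  Hence if the seminorms of
  \<open>\<phi>^j\<close> are at most \<open>M\<close> times those of \<open>z^j\<close>, evaluating the derivative of \<open>\<phi>^j\<close> at a point
  \<open>z\<close>, with \<open>j\<close> adapted to \<open>w = \<phi> z\<close>, gives the pointwise inequality
  \<open>\<mu> z * norm (\<phi>' z) \<le> C * v_log (\<phi> z)\<close> (\<open>monomial_bound_imp_pointwise\<close>).  By the chain rule
  this controls the seminorm of \<open>f \<circ> \<phi>\<close> by that of \<open>f\<close>; the remaining term \<open>norm (f (\<phi> 0))\<close>
  of the norm is controlled because point evaluations are bounded on the log-Bloch space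
  (\<open>v_log_point_evaluation\<close>).

  The other direction is a test on the monomials \<open>z^j\<close> with \<open>j \<ge> 1\<close>, which lie in the log-Bloch
  space, have positive seminorm and vanish at the origin, so that norm and seminorm agree on them.
\<close>

section \<open>Extended-valued seminorms\<close>

lemma bloch_seminorm_le_iff:
  assumes "0 \<le> B"
  shows "bloch_seminorm \<mu> f \<le> ennreal B \<longleftrightarrow> (\<forall>z\<in>unit_disk. \<mu> z * norm (deriv f z) \<le> B)"
  using assms by (simp add: bloch_seminorm_def SUP_le_iff)

lemma bloch_space_realE:
  assumes "f \<in> bloch_space \<mu>"
  obtains s where "0 \<le> s" "bloch_seminorm \<mu> f = ennreal s"
    "\<And>z. z \<in> unit_disk \<Longrightarrow> \<mu> z * norm (deriv f z) \<le> s"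
proof -
  have fin: "bloch_seminorm \<mu> f < top"
    using assms by (simp add: bloch_space_def)
  then obtain s where s: "0 \<le> s" "bloch_seminorm \<mu> f = ennreal s"
    by (cases "bloch_seminorm \<mu> f") auto
  then show thesis
    using that[of s] bloch_seminorm_le_iff[of s \<mu> f] by auto
qed

section \<open>The logarithmic weight and monomials\<close>

lemma v_log_lower: "1 - norm z \<le> v_log z" if "z \<in> unit_disk"
proof -
  have t: "0 < 1 - norm z" "1 - norm z \<le> 1" using that by auto
  have "exp 1 \<le> (3::real)" by (rule exp_le)
  also have "3 \<le> 3 / (1 - norm z)" using t by (simp add: field_simps)
  finally have "1 \<le> ln (3 / (1 - norm z))"
    using t by (subst ln_ge_iff) auto
  then show ?thesis
    using mult_left_mono[of 1 "ln (3 / (1 - norm z))" "1 - norm z"] t by (simp add: v_log_def)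
qed

lemma one_le_ln_3_mult: "1 \<le> ln (3 * real j)" if "1 \<le> j"
proof -
  have "exp 1 \<le> (3::real)" by (rule exp_le)
  also have "3 \<le> 3 * real j" using that by simp
  finally show ?thesis using that by (subst ln_ge_iff) auto
qed

text \<open>
  With \<open>u = j t\<close> the left side is at most \<open>e \<cdot> exp (- u) \<cdot> u (ln (3 j) - ln u)\<close>,
  where both \<open>u exp (- u)\<close> and \<open>- u ln u\<close> are at most \<open>1\<close>.
\<close>

lemma monomial_log_upper:
  fixes t :: real
  assumes t: "0 < t" "t \<le> 1" and j: "1 \<le> j"
  shows "real j * (1 - t) ^ (j - 1) * (t * ln (3 / t)) \<le> 2 * exp 1 * ln (3 * real j)"
proof -
  define u where "u = real j * t"
  define L where "L = ln (3 * real j)"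
  have u: "0 < u" using t j by (simp add: u_def)
  have L: "1 \<le> L" unfolding L_def by (rule one_le_ln_3_mult[OF j])
  have "1 - t \<le> exp (- t)" using exp_ge_add_one_self[of "- t"] by simp
  then have "(1 - t) ^ (j - 1) \<le> exp (- t) ^ (j - 1)"
    using t by (intro power_mono) auto
  also have "\<dots> = exp (t - u)"
    using j by (simp add: exp_of_nat_mult[symmetric] u_def of_nat_diff algebra_simps)
  also have "\<dots> \<le> exp 1 * exp (- u)"
    using t by (simp add: exp_add[symmetric])
  finally have p: "(1 - t) ^ (j - 1) \<le> exp 1 * exp (- u)" .
  have "- ln u = ln (1 / u)" using u by (simp add: ln_div)
  also have "\<dots> \<le> 1 / u - 1" using u by (intro ln_le_minus_one) auto
  finally have "u * (- ln u) \<le> u * (1 / u - 1)"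
    using u by (intro mult_left_mono) auto
  also have "\<dots> \<le> 1" using u by (simp add: algebra_simps)
  finally have ulnu: "u * (- ln u) \<le> 1" .
  have ln_split: "ln (3 / t) = L - ln u"
    using t j by (simp add: L_def u_def ln_div ln_mult)
  have uL: "u * ln (3 / t) \<le> u * L + 1"
    unfolding ln_split using ulnu by (simp add: algebra_simps)
  have "u \<le> exp u" using exp_ge_add_one_self[of u] by linarith
  then have eu: "exp (- u) * u \<le> 1" "exp (- u) \<le> 1"
    using u by (auto simp: exp_minus field_simps)
  have lnt: "0 \<le> ln (3 / t)" using t by (intro ln_ge_zero) (simp add: field_simps)
  have "real j * (1 - t) ^ (j - 1) * (t * ln (3 / t)) = (1 - t) ^ (j - 1) * (u * ln (3 / t))"
    by (simp add: u_def)
  also have "\<dots> \<le> exp 1 * exp (- u) * (u * ln (3 / t))"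
    using p u lnt by (intro mult_right_mono) auto
  also have "\<dots> \<le> exp 1 * exp (- u) * (u * L + 1)"
    using uL by (intro mult_left_mono) auto
  also have "\<dots> = exp 1 * ((exp (- u) * u) * L + exp (- u))"
    by (simp add: algebra_simps)
  also have "\<dots> \<le> exp 1 * (1 * L + 1)"
    using eu L by (intro mult_left_mono add_mono mult_right_mono) auto
  also have "\<dots> \<le> exp 1 * (2 * L)"
    using L by (intro mult_left_mono) auto
  finally show ?thesis by (simp add: L_def algebra_simps)
qed

text \<open>
  The choice is \<open>j = \<lfloor>1 / t\<rfloor>\<close>: then \<open>j t \<le> 1\<close> keeps \<open>(1 - t)^(j-1)\<close> above \<open>1 / e\<close> and makes
  \<open>ln (3 / t)\<close> at least \<open>ln (3 j)\<close>, while maximality of \<open>j\<close> keeps \<open>j t\<close> above \<open>1 / 2\<close>.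
\<close>

lemma monomial_log_lower:
  fixes t :: real
  assumes t: "0 < t" "t \<le> 1"
  obtains j :: nat where "1 \<le> j"
    and "ln (3 * real j) \<le> 2 * exp 1 * (real j * (1 - t) ^ (j - 1) * (t * ln (3 / t)))"
    and "0 < (1 - t) ^ (j - 1)"
proof -
  define j where "j = nat \<lfloor>1 / t\<rfloor>"
  have fl: "1 \<le> \<lfloor>1 / t\<rfloor>" using t by (simp add: le_floor_iff)
  then have j: "1 \<le> j" unfolding j_def by linarith
  have rj: "real j = of_int \<lfloor>1 / t\<rfloor>" unfolding j_def using fl by linarith
  have "real j \<le> 1 / t" unfolding rj by (rule of_int_floor_le)
  then have jt: "real j * t \<le> 1" using t by (simp add: field_simps)
  have "1 / t < real j + 1" unfolding rj by linarith
  then have "1 < (real j + 1) * t" using t by (simp add: field_simps)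
  also have "\<dots> \<le> 2 * real j * t" using j t by (intro mult_right_mono) auto
  finally have jt2: "1 \<le> 2 * real j * t" by simp
  have p: "1 \<le> exp 1 * (1 - t) ^ (j - 1)"
  proof (cases "t = 1")
    case True
    then have "j = 1" using jt j by simp
    then show ?thesis by simp
  next
    case False
    then have t1: "0 < 1 - t" using t by simp
    have "1 / (1 - t) = 1 + t / (1 - t)" using t1 by (simp add: field_simps)
    also have "\<dots> \<le> exp (t / (1 - t))" by (rule exp_ge_add_one_self)
    finally have "(1 / (1 - t)) ^ (j - 1) \<le> exp (t / (1 - t)) ^ (j - 1)"
      using t1 by (intro power_mono) auto
    also have "\<dots> = exp (real (j - 1) * (t / (1 - t)))"
      by (rule exp_of_nat_mult[symmetric])
    also have "\<dots> \<le> exp 1"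
      using jt t1 j by (simp add: field_simps of_nat_diff)
    finally show ?thesis using t1 by (simp add: field_simps)
  qed
  have pos: "0 < (1 - t) ^ (j - 1)"
    by (rule zero_less_mult_pos[of "exp 1"]) (use p in auto)
  have "3 * real j \<le> 3 / t" using jt t by (simp add: field_simps)
  then have ln_le: "ln (3 * real j) \<le> ln (3 / t)" using j t by (subst ln_le_cancel_iff) auto
  have ln0: "1 \<le> ln (3 * real j)" by (rule one_le_ln_3_mult[OF j])
  have "ln (3 * real j) \<le> 1 * 1 * ln (3 / t)" using ln_le by simp
  also have "\<dots> \<le> (2 * real j * t) * (exp 1 * (1 - t) ^ (j - 1)) * ln (3 / t)"
    using jt2 p ln_le ln0 t by (intro mult_right_mono mult_mono) auto
  finally have "ln (3 * real j) \<le> 2 * exp 1 * (real j * (1 - t) ^ (j - 1) * (t * ln (3 / t)))"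
    by (simp add: algebra_simps)
  then show thesis using that j pos by blast
qed

lemma norm_deriv_monomial: "norm (deriv (\<lambda>z::complex. z ^ j) z) = real j * norm z ^ (j - 1)"
proof -
  have "deriv (\<lambda>z::complex. z ^ j) z = of_nat j * z ^ (j - 1)"
    by (rule DERIV_imp_deriv) (auto intro!: derivative_eq_intros)
  then show ?thesis by (simp add: norm_mult norm_power)
qed

lemma bloch_seminorm_monomial_le:
  assumes "1 \<le> j"
  shows "bloch_seminorm v_log (\<lambda>z. z ^ j) \<le> ennreal (2 * exp 1 * ln (3 * real j))"
proof (subst bloch_seminorm_le_iff, goal_cases)
  case 1
  then show ?case using one_le_ln_3_mult[OF assms] by simp
next
  case 2
  have "v_log z * norm (deriv (\<lambda>z. z ^ j) z) \<le> 2 * exp 1 * ln (3 * real j)"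
    if "z \<in> unit_disk" for z
    using monomial_log_upper[of "1 - norm z" j] that assms
    by (simp add: norm_deriv_monomial v_log_def algebra_simps)
  then show ?case by blast
qed

lemma monomial_in_bloch_space: "1 \<le> j \<Longrightarrow> (\<lambda>z. z ^ j) \<in> bloch_space v_log"
  using le_less_trans[OF bloch_seminorm_monomial_le ennreal_less_top]
  by (auto simp: bloch_space_def intro!: holomorphic_intros)

lemma bloch_seminorm_monomial_neq_0:
  assumes "1 \<le> j"
  shows "bloch_seminorm v_log (\<lambda>z. z ^ j) \<noteq> 0"
proof
  assume "bloch_seminorm v_log (\<lambda>z. z ^ j) = 0"
  then have "v_log (1/2) * norm (deriv (\<lambda>z::complex. z ^ j) (1/2)) \<le> 0"
    using bloch_seminorm_le_iff[of 0 v_log "\<lambda>z. z ^ j"] by simp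
  moreover have "0 < v_log (1/2)"
    using v_log_lower[of "1/2"] by simp
  moreover have "0 < norm (deriv (\<lambda>z::complex. z ^ j) (1/2))"
    using assms by (simp add: norm_deriv_monomial norm_divide)
  ultimately show False
    by (smt (verit) mult_pos_pos)
qed

section \<open>Point evaluations\<close>

text \<open>
  On the disk of radius \<open>norm w\<close> the weight is at least \<open>1 - norm w\<close>, so the derivative is at most
  \<open>s / (1 - norm w)\<close> there; the estimate is the mean value inequality on that disk.
\<close>

lemma v_log_point_evaluation:
  assumes hol: "f holomorphic_on unit_disk"
    and s: "\<And>z. z \<in> unit_disk \<Longrightarrow> v_log z * norm (deriv f z) \<le> s"
    and w: "w \<in> unit_disk"
  shows "norm (f w) \<le> norm (f 0) + s / (1 - norm w)"
proof -
  have w1: "0 < 1 - norm w" using w by simp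
  have "0 \<le> v_log 0 * norm (deriv f 0)"
    using v_log_lower[of 0] by (intro mult_nonneg_nonneg) auto
  then have s0: "0 \<le> s" using s[of 0] by simp
  have bound: "norm (deriv f z) \<le> s / (1 - norm w)" if "z \<in> cball 0 (norm w)" for z
  proof -
    have z: "z \<in> unit_disk" using that w by auto
    have "(1 - norm w) * norm (deriv f z) \<le> v_log z * norm (deriv f z)"
      using v_log_lower[OF z] that by (intro mult_right_mono) auto
    also have "\<dots> \<le> s" by (rule s[OF z])
    finally show ?thesis using w1 by (simp add: field_simps)
  qed
  have "norm (f w - f 0) \<le> s / (1 - norm w) * norm (w - 0)"
  proof (rule field_differentiable_bound[where S = "cball 0 (norm w)" and f' = "deriv f"])
    fix z :: complex assume "z \<in> cball 0 (norm w)"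
    then have "z \<in> unit_disk" using w by auto
    then show "(f has_field_derivative deriv f z) (at z within cball 0 (norm w))"
      using holomorphic_derivI[OF hol open_ball] by blast
  qed (use bound in auto)
  also have "\<dots> \<le> s / (1 - norm w) * 1"
    using w1 s0 by (intro mult_left_mono) auto
  finally show ?thesis using norm_triangle_ineq2[of "f w" "f 0"] by simp
qed

section \<open>The pointwise criterion\<close>

lemma norm_deriv_power:
  assumes "\<phi> holomorphic_on unit_disk" "z \<in> unit_disk"
  shows "norm (deriv (\<lambda>z. \<phi> z ^ j) z) = real j * norm (\<phi> z) ^ (j - 1) * norm (deriv \<phi> z)"
proof -
  have "(\<phi> has_field_derivative deriv \<phi> z) (at z)"
    using holomorphic_derivI[OF assms(1) open_ball assms(2)] .
  then have "deriv (\<lambda>z. \<phi> z ^ j) z = of_nat j * (deriv \<phi> z * \<phi> z ^ (j - 1))"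
    by (intro DERIV_imp_deriv) (auto intro!: derivative_eq_intros)
  then show ?thesis by (simp add: norm_mult norm_power)
qed

text \<open>
  The power \<open>j\<close> is adapted to \<open>\<phi> z\<close>, so that the bound on \<open>\<phi>^j\<close> evaluated at \<open>z\<close> loses only
  a constant factor.  The constant \<open>4 e\<^sup>2\<close> is the product of those in the upper and the lower estimate
  for monomials.
\<close>

lemma monomial_bound_imp_pointwise:
  assumes hol: "\<phi> holomorphic_on unit_disk"
    and z: "z \<in> unit_disk" and \<phi>z: "\<phi> z \<in> unit_disk"
    and M: "0 \<le> M"
      "\<And>j. 1 \<le> j \<Longrightarrow>
        bloch_seminorm \<mu> (\<lambda>z. \<phi> z ^ j) \<le> ennreal M * bloch_seminorm v_log (\<lambda>z. z ^ j)"
  shows "\<mu> z * norm (deriv \<phi> z) \<le> 4 * (exp 1)\<^sup>2 * M * v_log (\<phi> z)"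
proof -
  define t where "t = 1 - norm (\<phi> z)"
  have t: "0 < t" "t \<le> 1" using \<phi>z by (auto simp: t_def)
  obtain j where j: "1 \<le> j"
    and lower: "ln (3 * real j) \<le> 2 * exp 1 * (real j * (1 - t) ^ (j - 1) * (t * ln (3 / t)))"
    and pos: "0 < (1 - t) ^ (j - 1)"
    using monomial_log_lower[OF t] by blast
  define D where "D = real j * (1 - t) ^ (j - 1)"
  have D: "0 < D" using j pos by (simp add: D_def)
  have v: "t * ln (3 / t) = v_log (\<phi> z)" by (simp add: v_log_def t_def)
  have "bloch_seminorm \<mu> (\<lambda>z. \<phi> z ^ j) \<le> ennreal M * ennreal (2 * exp 1 * ln (3 * real j))"
    using order_trans[OF M(2)[OF j] mult_left_mono[OF bloch_seminorm_monomial_le[OF j]]] by simp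
  also have "\<dots> = ennreal (M * (2 * exp 1 * ln (3 * real j)))"
    using M(1) by (simp add: ennreal_mult')
  finally have "\<mu> z * norm (deriv (\<lambda>z. \<phi> z ^ j) z) \<le> M * (2 * exp 1 * ln (3 * real j))"
    using z M(1) one_le_ln_3_mult[OF j] by (subst (asm) bloch_seminorm_le_iff) auto
  then have "\<mu> z * norm (deriv \<phi> z) * D \<le> M * (2 * exp 1 * ln (3 * real j))"
    by (simp add: norm_deriv_power[OF hol z] D_def t_def algebra_simps)
  also have "\<dots> \<le> M * (2 * exp 1 * (2 * exp 1 * (D * v_log (\<phi> z))))"
    using lower M(1) by (intro mult_left_mono) (auto simp: D_def v)
  also have "\<dots> = 4 * (exp 1)\<^sup>2 * M * v_log (\<phi> z) * D"
    by (simp add: power2_eq_square)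
  finally show ?thesis using D by simp
qed

text \<open>
  The constant is the sum of \<open>1\<close> for the value at the origin, \<open>1 / (1 - norm (\<phi> 0))\<close> for moving the
  evaluation point from the origin to \<open>\<phi> 0\<close>, and \<open>C\<close> for the seminorm.
\<close>

lemma pointwise_imp_bounded:
  assumes hol: "\<phi> holomorphic_on unit_disk"
    and maps: "\<phi> ` unit_disk \<subseteq> unit_disk"
    and C: "0 \<le> C" "\<And>z. z \<in> unit_disk \<Longrightarrow> \<mu> z * norm (deriv \<phi> z) \<le> C * v_log (\<phi> z)"
  shows "bounded_bloch_op v_log \<mu> (comp_op \<phi>)"
proof -
  define E where "E = 1 / (1 - norm (\<phi> 0))"
  have \<phi>0: "\<phi> 0 \<in> unit_disk" using maps by force
  then have E: "0 \<le> E" by (simp add: E_def)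
  have "bloch_norm \<mu> (comp_op \<phi> f) \<le> ennreal (1 + E + C) * bloch_norm v_log f"
    if f: "f \<in> bloch_space v_log" for f
  proof -
    obtain s where s: "0 \<le> s" "bloch_seminorm v_log f = ennreal s"
      "\<And>z. z \<in> unit_disk \<Longrightarrow> v_log z * norm (deriv f z) \<le> s"
      using bloch_space_realE[OF f] by blast
    have fhol: "f holomorphic_on unit_disk" using f by (simp add: bloch_space_def)
    have "\<mu> z * norm (deriv (f \<circ> \<phi>) z) \<le> C * s" if z: "z \<in> unit_disk" for z
    proof -
      have \<phi>z: "\<phi> z \<in> unit_disk" using maps z by blast
      have "deriv (f \<circ> \<phi>) z = deriv f (\<phi> z) * deriv \<phi> z"
        by (intro deriv_chain holomorphic_on_imp_differentiable_at[OF hol]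
            holomorphic_on_imp_differentiable_at[OF fhol] z \<phi>z open_ball)
      then have "\<mu> z * norm (deriv (f \<circ> \<phi>) z) = \<mu> z * norm (deriv \<phi> z) * norm (deriv f (\<phi> z))"
        by (simp add: norm_mult)
      also have "\<dots> \<le> C * v_log (\<phi> z) * norm (deriv f (\<phi> z))"
        by (intro mult_right_mono C(2) z) simp
      also have "\<dots> \<le> C * s"
        using mult_left_mono[OF s(3)[OF \<phi>z] C(1)] by (simp add: mult.assoc)
      finally show ?thesis .
    qed
    then have semi: "bloch_seminorm \<mu> (f \<circ> \<phi>) \<le> ennreal (C * s)"
      using C(1) s(1) by (subst bloch_seminorm_le_iff) auto
    have pt: "norm (f (\<phi> 0)) \<le> norm (f 0) + E * s"
      using v_log_point_evaluation[OF fhol s(3) \<phi>0] by (simp add: E_def)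
    have "bloch_norm \<mu> (comp_op \<phi> f) \<le> ennreal (norm (f 0) + E * s) + ennreal (C * s)"
      unfolding bloch_norm_def comp_op_def
      using semi pt by (intro add_mono) (auto intro!: ennreal_leI)
    also have "\<dots> = ennreal (norm (f 0) + E * s + C * s)"
      using E C(1) s(1) by (intro ennreal_plus[symmetric]) auto
    also have "\<dots> \<le> ennreal ((1 + E + C) * (norm (f 0) + s))"
      using E C(1) s(1) by (intro ennreal_leI) (simp add: algebra_simps)
    also have "\<dots> = ennreal (1 + E + C) * bloch_norm v_log f"
      using E C(1) s(1) by (simp add: bloch_norm_def s(2) ennreal_mult flip: ennreal_plus)
    finally show ?thesis .
  qed
  then show ?thesis unfolding bounded_bloch_op_def by blast
qed

section \<open>Boundedness and powers of the symbol\<close>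

theorem theorem3p1:
  fixes \<mu> :: "complex \<Rightarrow> real" and \<phi> :: "complex \<Rightarrow> complex"
  assumes "weight \<mu>"
    and "\<phi> holomorphic_on unit_disk"
    and "\<phi> ` unit_disk \<subseteq> unit_disk"
    and "\<forall>f\<in>bloch_space v_log. comp_op \<phi> f \<in> bloch_space \<mu>"
  shows "bounded_bloch_op v_log \<mu> (comp_op \<phi>) \<longleftrightarrow>
    (SUP j\<in>{1::nat..}. bloch_seminorm \<mu> (\<lambda>z. \<phi> z ^ j) / bloch_seminorm v_log (\<lambda>z. z ^ j)) < \<infinity>"
    (is "?bdd \<longleftrightarrow> ?S < \<infinity>")
proof
  assume ?bdd
  then obtain C where C: "\<And>f. f \<in> bloch_space v_log \<Longrightarrow>
      bloch_norm \<mu> (comp_op \<phi> f) \<le> ennreal C * bloch_norm v_log f"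
    unfolding bounded_bloch_op_def by blast
  have "bloch_seminorm \<mu> (\<lambda>z. \<phi> z ^ j) / bloch_seminorm v_log (\<lambda>z. z ^ j) \<le> ennreal C"
    if j: "1 \<le> j" for j :: nat
  proof -
    let ?F = "\<lambda>z::complex. z ^ j"
    have fin: "bloch_seminorm v_log ?F < top"
      using monomial_in_bloch_space[OF j] by (simp add: bloch_space_def)
    have "bloch_seminorm \<mu> (\<lambda>z. \<phi> z ^ j) \<le> bloch_norm \<mu> (comp_op \<phi> ?F)"
      by (simp add: bloch_norm_def comp_op_def o_def)
    also have "\<dots> \<le> ennreal C * bloch_norm v_log ?F"
      by (rule C[OF monomial_in_bloch_space[OF j]])
    also have "bloch_norm v_log ?F = bloch_seminorm v_log ?F"
      using j by (simp add: bloch_norm_def)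
    finally have "bloch_seminorm \<mu> (\<lambda>z. \<phi> z ^ j) / bloch_seminorm v_log ?F
        \<le> ennreal C * bloch_seminorm v_log ?F / bloch_seminorm v_log ?F"
      by (rule divide_right_mono_ennreal)
    also have "\<dots> = ennreal C"
      using fin bloch_seminorm_monomial_neq_0[OF j] by (simp add: ennreal_mult_divide_eq)
    finally show ?thesis .
  qed
  then have "?S \<le> ennreal C" by (intro SUP_least) auto
  then show "?S < \<infinity>" using le_less_trans[OF _ ennreal_less_top] by simp
next
  assume "?S < \<infinity>"
  then have "?S \<noteq> top" by (simp only: infinity_ennreal_def less_irrefl less_top)
  then obtain M where M: "0 \<le> M" "?S = ennreal M" by (cases ?S rule: ennreal_cases) blast+
  have bound: "bloch_seminorm \<mu> (\<lambda>z. \<phi> z ^ j) \<le> ennreal M * bloch_seminorm v_log (\<lambda>z. z ^ j)"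
    if j: "1 \<le> j" for j :: nat
  proof -
    let ?a = "bloch_seminorm \<mu> (\<lambda>z. \<phi> z ^ j)" and ?b = "bloch_seminorm v_log (\<lambda>z. z ^ j)"
    have fin: "?b < top"
      using monomial_in_bloch_space[OF j] by (simp add: bloch_space_def)
    have "?a / ?b \<le> ennreal M"
      unfolding M(2)[symmetric] using j by (intro SUP_upper) auto
    then have "?a / ?b * ?b \<le> ennreal M * ?b" by (rule mult_right_mono) simp
    moreover have "?a / ?b * ?b = ?a"
      using fin bloch_seminorm_monomial_neq_0[OF j]
      by (simp add: ennreal_divide_times ennreal_mult_divide_eq)
    ultimately show ?thesis by simp
  qed
  have "\<mu> z * norm (deriv \<phi> z) \<le> 4 * (exp 1)\<^sup>2 * M * v_log (\<phi> z)" if "z \<in> unit_disk" for z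
    using monomial_bound_imp_pointwise[OF assms(2) that _ M(1) bound] assms(3) that by blast
  then show ?bdd
    using pointwise_imp_bounded[OF assms(2,3), of "4 * (exp 1)\<^sup>2 * M"] M(1) by simp
qed

end
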